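(* If $x$ is a complex number, then for any integer $n\ge 0$ we have $$\sum_{k=0}^n \binom{2k}{k} 2^{-2k} x^k = 2^{-2n} (2n+1) \binom{2n}{n} \sum_{k=0}^n \binom{n}{k} (-1)^k \frac{(1-x)^k}{2k+1}$$ and $$\sum_{k=0}^n \binom{2k}{k} 2^{-2k} \frac{(1+x)^k}{2k-1} = 2^{-2n} \binom{2n}{n} \sum_{k=0}^n \binom{n}{k} \frac{x^k}{2k-1}.$$
   Context: The convention $0^0=1$ is used for zeroth powers. *)

theory Defs
  imports Complex_Main
begin

end

theory Submission
  imports Defs
begin

text \<open>
  Write \<open>c n = binom(2n, n) / 4^n\<close> (this is \<open>central_weight n\<close>) and
  \<open>U n = (\<Sum>k\<le>n. binom(n, k) z^k / (2k + a))\<close>.  With \<open>a = 1\<close> and \<open>z = x - 1\<close> the first identity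
  evaluates the partial sums of \<open>c k (1 + z)^k\<close> as \<open>(2n + 1) c n U n\<close>; with \<open>a = -1\<close> and \<open>z = x\<close>
  the second evaluates the partial sums of \<open>c k (1 + z)^k / (2k - 1)\<close> as \<open>c n U n\<close>.  Each is proved
  by telescoping in \<open>n\<close>.

  The sum \<open>U\<close> satisfies \<open>(2(n + 1) + a) U (n + 1) = 2(n + 1) U n + (1 + z)^(n + 1)\<close>
  (lemma \<open>binomial_linear_denominator_recurrence\<close>), and \<open>c\<close> satisfies
  \<open>2(n + 1) c (n + 1) = (2n + 1) c n\<close> (lemma \<open>central_weight_Suc\<close>).  Multiplying the former by
  \<open>c (n + 1)\<close> and rewriting with the latter gives
  \<open>(2(n + 1) + a) c (n + 1) U (n + 1) = (2n + 1) c n U n + c (n + 1) (1 + z)^(n + 1)\<close>.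
  For \<open>a = 1\<close>, and for \<open>a = -1\<close> after division by \<open>2n + 1\<close>, this says that passing from \<open>n\<close> to
  \<open>n + 1\<close> increases the closed form by exactly the next summand.
\<close>

text \<open>
  The denominator \<open>2k + a\<close> is cancelled by splitting
  \<open>2(n + 1) + a = (2k + a) + 2(n + 1 - k)\<close>: the first part yields the binomial expansion of
  \<open>(1 + z)^(n + 1)\<close>, and the absorption identity
  \<open>(n + 1 - k) binom(n + 1, k) = (n + 1) binom(n, k)\<close> lets the second part yield the sum for \<open>n\<close>.
\<close>

lemma binomial_linear_denominator_recurrence:
  fixes a z :: "'a :: field_char_0"
  assumes nz: "\<And>k. 2 * of_nat k + a \<noteq> 0"
  shows "(2 * of_nat (Suc n) + a) * (\<Sum>k=0..Suc n. of_nat (Suc n choose k) * (z ^ k / (2 * of_nat k + a)))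
    = 2 * of_nat (Suc n) * (\<Sum>k=0..n. of_nat (n choose k) * (z ^ k / (2 * of_nat k + a)))
      + (1 + z) ^ Suc n"
proof -
  let ?w = "\<lambda>k. z ^ k / (2 * of_nat k + a)"
  have term_eq: "(2 * of_nat (Suc n) + a) * (of_nat (Suc n choose k) * ?w k)
      = 2 * of_nat (Suc n) * (of_nat (n choose k) * ?w k) + of_nat (Suc n choose k) * z ^ k"
    if "k \<le> Suc n" for k
  proof -
    have absorb: "of_nat (Suc n) * of_nat (n choose k)
        = (of_nat (Suc n) - of_nat k) * (of_nat (Suc n choose k) :: 'a)"
      using binomial_absorb_comp[of "Suc n" k] that
      by (metis diff_Suc_1 of_nat_diff of_nat_mult)
    have "(2 * of_nat (Suc n) + a) * (of_nat (Suc n choose k) * ?w k)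
        = 2 * ((of_nat (Suc n) - of_nat k) * of_nat (Suc n choose k)) * ?w k
          + of_nat (Suc n choose k) * ((2 * of_nat k + a) * ?w k)"
      by (simp only: algebra_simps)
    also have "(2 * of_nat k + a) * ?w k = z ^ k"
      using nz[of k] by simp
    finally show ?thesis
      by (simp only: absorb[symmetric] mult.assoc)
  qed
  have "(2 * of_nat (Suc n) + a) * (\<Sum>k=0..Suc n. of_nat (Suc n choose k) * ?w k)
      = 2 * of_nat (Suc n) * (\<Sum>k=0..Suc n. of_nat (n choose k) * ?w k)
        + (\<Sum>k=0..Suc n. of_nat (Suc n choose k) * z ^ k)"
    unfolding sum_distrib_left sum.distrib[symmetric]
    by (rule sum.cong[OF refl], rule term_eq) simp
  also have "(\<Sum>k=0..Suc n. of_nat (n choose k) * ?w k) = (\<Sum>k=0..n. of_nat (n choose k) * ?w k)"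
    by simp
  also have "(\<Sum>k=0..Suc n. of_nat (Suc n choose k) * z ^ k) = (1 + z) ^ Suc n"
    using binomial_ring[of z 1 "Suc n"] by (simp add: atLeast0AtMost add.commute)
  finally show ?thesis .
qed

definition central_weight :: "nat \<Rightarrow> 'a :: field_char_0" where
  "central_weight n = of_nat ((2 * n) choose n) * 2 powi (- 2 * int n)"

lemma central_weight_Suc:
  "2 * of_nat (Suc n) * central_weight (Suc n)
    = (2 * of_nat n + 1) * (central_weight n :: 'a :: field_char_0)"
proof -
  have top: "Suc n * ((2 * Suc n) choose Suc n) = (2 * Suc n) * ((2 * n + 1) choose n)"
    using binomial_absorption[of n "2 * Suc n"] by (simp del: binomial_Suc_Suc)
  have bottom: "Suc n * ((2 * n + 1) choose n) = (2 * n + 1) * ((2 * n) choose n)"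
    using binomial_absorb_comp[of "2 * n + 1" n] by (simp del: binomial_Suc_Suc)
  have "Suc n * ((2 * Suc n) choose Suc n) = 2 * (Suc n * ((2 * n + 1) choose n))"
    unfolding top by (simp only: ac_simps)
  then have nat_eq: "Suc n * ((2 * Suc n) choose Suc n) = 2 * ((2 * n + 1) * ((2 * n) choose n))"
    by (simp only: bottom)
  have binom_eq: "of_nat (Suc n) * of_nat ((2 * Suc n) choose Suc n)
      = 2 * ((2 * of_nat n + 1) * (of_nat ((2 * n) choose n) :: 'a))"
    using arg_cong[OF nat_eq, of "of_nat :: nat \<Rightarrow> 'a"]
    by (simp only: of_nat_mult of_nat_add of_nat_numeral of_nat_1)
  have "- 2 * int (Suc n) = - 2 * int n + - 2"
    by simp
  then have pow_eq: "2 powi (- 2 * int (Suc n)) = 2 powi (- 2 * int n) * (1 / 4 :: 'a)"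
    using power_int_add[of "2 :: 'a" "- 2 * int n" "- 2"]
    by (simp only:) (simp add: power_int_minus)
  have "2 * of_nat (Suc n) * (central_weight (Suc n) :: 'a)
      = 2 * (of_nat (Suc n) * of_nat ((2 * Suc n) choose Suc n)) * (2 powi (- 2 * int n) * (1 / 4))"
    unfolding central_weight_def pow_eq by (simp only: ac_simps)
  also have "\<dots> = (2 * of_nat n + 1) * central_weight n"
    unfolding binom_eq central_weight_def by (simp add: field_simps)
  finally show ?thesis .
qed

lemma sum_central_weight_power:
  fixes z :: "'a :: field_char_0"
  shows "(\<Sum>k=0..n. central_weight k * (1 + z) ^ k)
    = (2 * of_nat n + 1) * central_weight n
      * (\<Sum>k=0..n. of_nat (n choose k) * (z ^ k / (2 * of_nat k + 1)))"
proof (induction n)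
  case 0
  show ?case by (simp add: central_weight_def)
next
  case (Suc n)
  let ?U = "\<lambda>n. \<Sum>k=0..n. of_nat (n choose k) * (z ^ k / (2 * of_nat k + 1))"
  have nz: "2 * of_nat k + 1 \<noteq> (0 :: 'a)" for k
    using of_nat_neq_0[of "2 * k", where ?'a = 'a] by (simp add: add.commute)
  have "(\<Sum>k=0..Suc n. central_weight k * (1 + z) ^ k)
      = (2 * of_nat n + 1) * central_weight n * ?U n + central_weight (Suc n) * (1 + z) ^ Suc n"
    using Suc.IH by simp
  also have "\<dots> = central_weight (Suc n) * (2 * of_nat (Suc n) * ?U n + (1 + z) ^ Suc n)"
    unfolding central_weight_Suc[symmetric] by (simp only: distrib_left ac_simps)
  also have "\<dots> = central_weight (Suc n) * ((2 * of_nat (Suc n) + 1) * ?U (Suc n))"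
    by (simp only: binomial_linear_denominator_recurrence[OF nz])
  finally show ?case by (simp only: ac_simps)
qed

lemma sum_central_weight_power_div:
  fixes z :: "'a :: field_char_0"
  shows "(\<Sum>k=0..n. central_weight k * ((1 + z) ^ k / (2 * of_nat k - 1)))
    = central_weight n * (\<Sum>k=0..n. of_nat (n choose k) * (z ^ k / (2 * of_nat k - 1)))"
proof (induction n)
  case 0
  show ?case by (simp add: central_weight_def)
next
  case (Suc n)
  let ?U = "\<lambda>n. \<Sum>k=0..n. of_nat (n choose k) * (z ^ k / (2 * of_nat k - 1))"
  let ?d = "2 * of_nat (Suc n) - 1 :: 'a"
  have nz: "2 * of_nat k + - 1 \<noteq> (0 :: 'a)" for k
  proof
    assume "2 * of_nat k + - 1 = (0 :: 'a)"
    then have "of_nat (2 * k) = (of_nat 1 :: 'a)" by simp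
    then have "2 * k = 1" by (simp only: of_nat_eq_iff)
    then show False by presburger
  qed
  have rec: "?d * ?U (Suc n) = 2 * of_nat (Suc n) * ?U n + (1 + z) ^ Suc n"
    using binomial_linear_denominator_recurrence[OF nz, of n z]
    by (simp only: add_uminus_conv_diff)
  have d: "?d \<noteq> 0"
    using nz[of "Suc n"] by (simp only: add_uminus_conv_diff not_False_eq_True)
  have weight: "?d * central_weight n = 2 * of_nat (Suc n) * central_weight (Suc n)"
    unfolding central_weight_Suc by simp
  have "?d * (\<Sum>k=0..Suc n. central_weight k * ((1 + z) ^ k / (2 * of_nat k - 1)))
      = ?d * (central_weight n * ?U n + central_weight (Suc n) * ((1 + z) ^ Suc n / ?d))"
    using Suc.IH by simp
  also have "\<dots> = ?d * central_weight n * ?U n + central_weight (Suc n) * (1 + z) ^ Suc n"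
    by (simp only: distrib_left times_divide_eq_right mult.assoc
        nonzero_mult_div_cancel_left[OF d])
  also have "\<dots> = central_weight (Suc n) * (2 * of_nat (Suc n) * ?U n + (1 + z) ^ Suc n)"
    unfolding weight by (simp only: distrib_left ac_simps)
  also have "\<dots> = ?d * (central_weight (Suc n) * ?U (Suc n))"
    unfolding rec[symmetric] by (simp only: ac_simps)
  finally show ?case using d by (simp only: mult_cancel_left simp_thms)
qed

theorem corollary3p2:
  fixes x :: complex and n :: nat
  shows "(\<Sum>k=0..n. of_nat ((2 * k) choose k) * 2 powi (- 2 * int k) * x ^ k)
      = 2 powi (- 2 * int n) * (2 * of_nat n + 1) * of_nat ((2 * n) choose n)
        * (\<Sum>k=0..n. of_nat (n choose k) * (- 1) ^ k * ((1 - x) ^ k / (2 * of_nat k + 1)))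
    \<and> (\<Sum>k=0..n. of_nat ((2 * k) choose k) * 2 powi (- 2 * int k) * ((1 + x) ^ k / (2 * of_nat k - 1)))
      = 2 powi (- 2 * int n) * of_nat ((2 * n) choose n)
        * (\<Sum>k=0..n. of_nat (n choose k) * (x ^ k / (2 * of_nat k - 1)))"
proof -
  have sign: "(x - 1) ^ k = (- 1) ^ k * (1 - x) ^ k" for k
    by (simp add: power_mult_distrib[symmetric])
  have "(\<Sum>k=0..n. central_weight k * x ^ k)
      = (2 * of_nat n + 1) * central_weight n
        * (\<Sum>k=0..n. of_nat (n choose k) * (- 1) ^ k * ((1 - x) ^ k / (2 * of_nat k + 1)))"
    using sum_central_weight_power[of "x - 1" n] by (simp add: sign mult.assoc)
  then show ?thesis
    using sum_central_weight_power_div[of x n]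
    by (simp only: central_weight_def ac_simps simp_thms)
qed

end
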